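(* Let $(A,\mu,\alpha,\beta)$ be a regular BiHom-associative algebra, let $A^+=(A,\mu',\alpha,\beta)$ with $\mu'(x,y)=\mu(x,y)+\mu(\alpha^{-1}\beta(y),\beta^{-1}\alpha(x))$, and let $(V,\phi,\psi)$ be a BiHom-module. (1) If $(V,\phi,\psi)$ is a right BiHom-associative $A$-module with structure map $\rho_r$, then $(V,\phi,\psi)$ is a right special BiHom-Jordan $A^+$-module with the same structure map $\rho_r$. (2) If $(V,\phi,\psi)$ is a left BiHom-associative $A$-module with structure map $\rho_l$ and $\psi$ is invertible, then $(V,\phi,\psi)$ is a left special BiHom-Jordan $A^+$-module with the same structure map $\rho_l$.
   Context: $\mathbb{K}$ is an algebraically closed field of characteristic $0$; all vector spaces and (multi)linear maps are over $\mathbb{K}$. A BiHom-algebra $(A,\mu,\alpha,\beta)$ is a vector space $A$ with a bilinear map $\mu:A\times A\to A$ and linear maps $\alpha,\beta:A\to A$ with $\alpha\beta=\beta\alpha$. It is multiplicative if $\alpha(\mu(x,y))=\mu(\alpha(x),\alpha(y))$ and $\beta(\mu(x,y))=\mu(\beta(x),\beta(y))$ for all $x,y$. It is regular if $\alpha,\beta$ are algebra automorphisms. Its BiHom-associator is $as_{\alpha,\beta}(x,y,z)=\mu(\mu(x,y),\beta(z))-\mu(\alpha(x),\mu(y,z))$. A BiHom-associative algebra is a multiplicative BiHom-algebra with $as_{\alpha,\beta}=0$. A BiHom-Jordan algebra is a multiplicative BiHom-algebra with $\mu(\beta(x),\alpha(y))=\mu(\beta(y),\alpha(x))$ and $as_{\alpha,\beta}(\mu(\beta^2(x),\alpha\beta(x)),\alpha^2\beta(y),\alpha^3(x))=0$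 for all $x,y$. For a regular BiHom-associative algebra $A$, $A^+$ is a BiHom-Jordan algebra. A BiHom-module $(V,\phi,\psi)$ is a vector space with commuting linear self-maps $\phi,\psi$. A left structure map is a linear map $\rho_l:A\otimes V\to V$, $a\otimes v\mapsto a\cdot v$, with $\phi\rho_l=\rho_l(\alpha\otimes\phi)$, $\psi\rho_l=\rho_l(\beta\otimes\psi)$; a right structure map is a linear map $\rho_r:V\otimes A\to V$, $v\otimes a\mapsto v\cdot a$, with $\phi\rho_r=\rho_r(\phi\otimes\alpha)$, $\psi\rho_r=\rho_r(\psi\otimes\beta)$. A left BiHom-associative $A$-module is a BiHom-module with a left structure map satisfying $\rho_l\circ(\alpha\otimes\rho_l)=\rho_l\circ(\mu\otimes\psi)$; a right BiHom-associative $A$-module is a BiHom-module with a right structure map satisfying $\rho_r\circ(\phi\otimes\mu)=\rho_r\circ(\rho_r\otimes\beta)$. Let $J$ be a BiHom-Jordan algebra with twisting maps $\alpha,\beta$, whose product is written by juxtaposition; $\circlearrowleft_{(x,y,z)}$ denotes the sum over cyclic permutations. A right BiHom-Jordan $J$-module is a BiHom-module $(V,\phi,\psi)$ with a right structure map such that for all $x,y,z\in J$, $v\in V$: $$\circlearrowleft_{(x,y,z)}\{(\phi\psi^2(v)\cdot\alpha\beta(x)\alpha^2(y))\cdot\beta\alpha^3(z)-(\phi\psi^2(v)\cdot\beta\alpha^2(z))\cdot\alpha^2\beta(x)\alpha^3(y)\}=0,$$ \begin{align*}&((\psi^2(v)\cdot\beta\alpha(x))\cdot\beta\alpha^2(y))\cdot\beta\alpha^3(z)+((\psi^2(v)\cdot\beta\alpha(z))\cdot\beta\alpha^2(y))\cdot\beta\alpha^3(x)\\&+\phi^2\psi^2(v)\cdot(\beta\alpha(x)\alpha^2(z))\alpha^3(y)=(\phi\psi^2(v)\cdot\beta\alpha^2(x))\cdot\beta\alpha^2(y)\alpha^3(z)\\&+(\phi\psi^2(v)\cdot\beta\alpha^2(z))\cdot\beta\alpha^2(y)\alpha^3(x)+(\phi\psi^2(v)\cdot\beta\alpha^2(y))\cdot\alpha^2\beta(x)\alpha^3(z).\end{align*}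 It is called special if $\phi(v)\cdot\beta(x)\alpha(y)=(v\cdot\beta(x))\cdot\beta\alpha(y)+(v\cdot\beta(y))\cdot\alpha\beta(x)$ for all $x,y\in J$, $v\in V$. A left BiHom-Jordan $J$-module is a BiHom-module $(V,\phi,\psi)$ with $\psi$ invertible and a left structure map such that for all $x,y,z\in J$, $v\in V$: $$\circlearrowleft_{(x,y,z)}\{\beta^2\alpha^2(z)\cdot(\alpha\beta(x)\alpha^2(y)\cdot\phi^3(v))-\alpha\beta^2(x)\alpha^2\beta(y)\cdot(\beta\alpha^2(z)\cdot\phi^3(v))\}=0,$$ \begin{align*}&\beta^2\alpha^2(z)\cdot(\beta\alpha^2(y)\cdot(\alpha^2(x)\cdot\psi^{-1}\phi^3(v)))+\beta^2\alpha^2(x)\cdot(\beta\alpha^2(y)\cdot(\alpha^2(z)\cdot\psi^{-1}\phi^3(v)))\\&+((\beta^2(x)\beta\alpha(z))\beta\alpha^2(y))\cdot\phi^3\psi(v)=\beta^2\alpha(y)\beta\alpha^2(z)\cdot(\beta\alpha^2(x)\cdot\phi^3(v))\\&+\beta^2\alpha(y)\beta\alpha^2(x)\cdot(\beta\alpha^2(z)\cdot\phi^3(v))+\beta^2\alpha(x)\beta\alpha^2(z)\cdot(\beta\alpha^2(y)\cdot\phi^3(v)).\end{align*} It is called special if $\beta(x)\alpha(y)\cdot\psi(v)=\beta\alpha(x)\cdot(\alpha(y)\cdot v)+\beta\alpha(y)\cdot(\alpha(x)\cdot v)$ for all $x,y\in J$, $v\in V$. *)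

theory Defs
  imports "HOL-Computational_Algebra.Polynomial"
begin

definition cyclic_sum :: "('a \<Rightarrow> 'a \<Rightarrow> 'a \<Rightarrow> 'b::ab_group_add) \<Rightarrow> 'a \<Rightarrow> 'a \<Rightarrow> 'a \<Rightarrow> 'b" where
  "cyclic_sum f x y z = f x y z + f y z x + f z x y"

definition bihom_associator ::
  "('a \<Rightarrow> 'a \<Rightarrow> 'a::ab_group_add) \<Rightarrow> ('a \<Rightarrow> 'a) \<Rightarrow> ('a \<Rightarrow> 'a) \<Rightarrow> 'a \<Rightarrow> 'a \<Rightarrow> 'a \<Rightarrow> 'a" where
  "bihom_associator \<mu> \<alpha> \<beta> x y z = \<mu> (\<mu> x y) (\<beta> z) - \<mu> (\<alpha> x) (\<mu> y z)"

locale bihom_algebra =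
  A: vector_space scaleA
  for scaleA :: "'k::field \<Rightarrow> 'a::ab_group_add \<Rightarrow> 'a" +
  fixes \<mu> :: "'a \<Rightarrow> 'a \<Rightarrow> 'a" and \<alpha> \<beta> :: "'a \<Rightarrow> 'a"
  assumes mult_linear_left: "\<And>y. Vector_Spaces.linear scaleA scaleA (\<lambda>x. \<mu> x y)"
    and mult_linear_right: "\<And>x. Vector_Spaces.linear scaleA scaleA (\<mu> x)"
    and alpha_linear: "Vector_Spaces.linear scaleA scaleA \<alpha>"
    and beta_linear: "Vector_Spaces.linear scaleA scaleA \<beta>"
    and alpha_beta_commute: "\<alpha> \<circ> \<beta> = \<beta> \<circ> \<alpha>"

locale multiplicative_bihom_algebra = bihom_algebra +
  assumes alpha_mult: "\<alpha> (\<mu> x y) = \<mu> (\<alpha> x) (\<alpha> y)"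
    and beta_mult: "\<beta> (\<mu> x y) = \<mu> (\<beta> x) (\<beta> y)"

text \<open>Being multiplicative and bijective, the linear maps \<open>\<alpha>\<close> and \<open>\<beta>\<close> are algebra automorphisms.\<close>

locale regular_bihom_algebra = multiplicative_bihom_algebra +
  assumes alpha_bij: "bij \<alpha>" and beta_bij: "bij \<beta>"

locale bihom_associative_algebra = multiplicative_bihom_algebra +
  assumes associator_zero: "bihom_associator \<mu> \<alpha> \<beta> x y z = 0"

locale regular_bihom_associative_algebra = regular_bihom_algebra + bihom_associative_algebra

locale bihom_jordan_algebra = multiplicative_bihom_algebra +
  assumes bihom_commutative: "\<mu> (\<beta> x) (\<alpha> y) = \<mu> (\<beta> y) (\<alpha> x)"
    and bihom_jordan_identity:
      "bihom_associator \<mu> \<alpha> \<beta> (\<mu> ((\<beta>^^2) x) (\<alpha> (\<beta> x))) ((\<alpha>^^2) (\<beta> y)) ((\<alpha>^^3) x) = 0"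

text \<open>The product of \<open>A\<^sup>+\<close>; it is only meaningful for bijective \<open>\<alpha>\<close> and \<open>\<beta>\<close>.\<close>

definition plus_mult ::
  "('a \<Rightarrow> 'a \<Rightarrow> 'a::ab_group_add) \<Rightarrow> ('a \<Rightarrow> 'a) \<Rightarrow> ('a \<Rightarrow> 'a) \<Rightarrow> 'a \<Rightarrow> 'a \<Rightarrow> 'a" where
  "plus_mult \<mu> \<alpha> \<beta> x y = \<mu> x y + \<mu> (inv \<alpha> (\<beta> y)) (inv \<beta> (\<alpha> x))"

locale bihom_module =
  V: vector_space scaleV
  for scaleV :: "'k::field \<Rightarrow> 'v::ab_group_add \<Rightarrow> 'v" +
  fixes \<phi> \<psi> :: "'v \<Rightarrow> 'v"
  assumes phi_linear: "Vector_Spaces.linear scaleV scaleV \<phi>"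
    and psi_linear: "Vector_Spaces.linear scaleV scaleV \<psi>"
    and phi_psi_commute: "\<phi> \<circ> \<psi> = \<psi> \<circ> \<phi>"

text \<open>
  A linear map \<open>A \<otimes> V \<rightarrow> V\<close> is represented by the corresponding bilinear map, and identities
  between linear maps on a tensor product are stated on pure tensors.
\<close>

locale left_structure_map =
  A: bihom_algebra scaleA \<mu> \<alpha> \<beta> + V: bihom_module scaleV \<phi> \<psi>
  for scaleA :: "'k::field \<Rightarrow> 'a::ab_group_add \<Rightarrow> 'a"
    and \<mu> :: "'a \<Rightarrow> 'a \<Rightarrow> 'a" (infixl \<open>\<star>\<close> 75)
    and \<alpha> \<beta> :: "'a \<Rightarrow> 'a"
    and scaleV :: "'k \<Rightarrow> 'v::ab_group_add \<Rightarrow> 'v"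
    and \<phi> \<psi> :: "'v \<Rightarrow> 'v" +
  fixes \<rho> :: "'a \<Rightarrow> 'v \<Rightarrow> 'v" (infix \<open>\<cdot>\<close> 70)
  assumes act_linear_left: "\<And>v. Vector_Spaces.linear scaleA scaleV (\<lambda>a. a \<cdot> v)"
    and act_linear_right: "\<And>a. Vector_Spaces.linear scaleV scaleV (\<lambda>v. a \<cdot> v)"
    and phi_act: "\<phi> (a \<cdot> v) = \<alpha> a \<cdot> \<phi> v"
    and psi_act: "\<psi> (a \<cdot> v) = \<beta> a \<cdot> \<psi> v"

locale right_structure_map =
  A: bihom_algebra scaleA \<mu> \<alpha> \<beta> + V: bihom_module scaleV \<phi> \<psi>
  for scaleA :: "'k::field \<Rightarrow> 'a::ab_group_add \<Rightarrow> 'a"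
    and \<mu> :: "'a \<Rightarrow> 'a \<Rightarrow> 'a" (infixl \<open>\<star>\<close> 75)
    and \<alpha> \<beta> :: "'a \<Rightarrow> 'a"
    and scaleV :: "'k \<Rightarrow> 'v::ab_group_add \<Rightarrow> 'v"
    and \<phi> \<psi> :: "'v \<Rightarrow> 'v" +
  fixes \<rho> :: "'v \<Rightarrow> 'a \<Rightarrow> 'v" (infix \<open>\<cdot>\<close> 70)
  assumes act_linear_left: "\<And>a. Vector_Spaces.linear scaleV scaleV (\<lambda>v. v \<cdot> a)"
    and act_linear_right: "\<And>v. Vector_Spaces.linear scaleA scaleV (\<lambda>a. v \<cdot> a)"
    and phi_act: "\<phi> (v \<cdot> a) = \<phi> v \<cdot> \<alpha> a"
    and psi_act: "\<psi> (v \<cdot> a) = \<psi> v \<cdot> \<beta> a"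

locale left_bihom_associative_module =
  left_structure_map + bihom_associative_algebra scaleA \<mu> \<alpha> \<beta> +
  assumes act_assoc: "\<alpha> a \<cdot> (b \<cdot> v) = (a \<star> b) \<cdot> \<psi> v"

locale right_bihom_associative_module =
  right_structure_map + bihom_associative_algebra scaleA \<mu> \<alpha> \<beta> +
  assumes act_assoc: "\<phi> v \<cdot> (a \<star> b) = (v \<cdot> a) \<cdot> \<beta> b"

locale right_bihom_jordan_module =
  right_structure_map + bihom_jordan_algebra scaleA \<mu> \<alpha> \<beta> +
  assumes right_jordan_cyclic:
    "cyclic_sum (\<lambda>x y z.
        (\<phi> ((\<psi>^^2) v) \<cdot> (\<alpha> (\<beta> x) \<star> (\<alpha>^^2) y)) \<cdot> \<beta> ((\<alpha>^^3) z)
        - (\<phi> ((\<psi>^^2) v) \<cdot> \<beta> ((\<alpha>^^2) z)) \<cdot> ((\<alpha>^^2) (\<beta> x) \<star> (\<alpha>^^3) y)) x y z = 0"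
    and right_jordan_identity:
    "(((\<psi>^^2) v \<cdot> \<beta> (\<alpha> x)) \<cdot> \<beta> ((\<alpha>^^2) y)) \<cdot> \<beta> ((\<alpha>^^3) z)
      + (((\<psi>^^2) v \<cdot> \<beta> (\<alpha> z)) \<cdot> \<beta> ((\<alpha>^^2) y)) \<cdot> \<beta> ((\<alpha>^^3) x)
      + (\<phi>^^2) ((\<psi>^^2) v) \<cdot> ((\<beta> (\<alpha> x) \<star> (\<alpha>^^2) z) \<star> (\<alpha>^^3) y)
      = (\<phi> ((\<psi>^^2) v) \<cdot> \<beta> ((\<alpha>^^2) x)) \<cdot> (\<beta> ((\<alpha>^^2) y) \<star> (\<alpha>^^3) z)
      + (\<phi> ((\<psi>^^2) v) \<cdot> \<beta> ((\<alpha>^^2) z)) \<cdot> (\<beta> ((\<alpha>^^2) y) \<star> (\<alpha>^^3) x)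
      + (\<phi> ((\<psi>^^2) v) \<cdot> \<beta> ((\<alpha>^^2) y)) \<cdot> ((\<alpha>^^2) (\<beta> x) \<star> (\<alpha>^^3) z)"

locale right_special_bihom_jordan_module = right_bihom_jordan_module +
  assumes right_special:
    "\<phi> v \<cdot> (\<beta> x \<star> \<alpha> y) = (v \<cdot> \<beta> x) \<cdot> \<beta> (\<alpha> y) + (v \<cdot> \<beta> y) \<cdot> \<alpha> (\<beta> x)"

locale left_bihom_jordan_module =
  left_structure_map + bihom_jordan_algebra scaleA \<mu> \<alpha> \<beta> +
  assumes psi_bij: "bij \<psi>"
    and left_jordan_cyclic:
    "cyclic_sum (\<lambda>x y z.
        (\<beta>^^2) ((\<alpha>^^2) z) \<cdot> ((\<alpha> (\<beta> x) \<star> (\<alpha>^^2) y) \<cdot> (\<phi>^^3) v)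
        - (\<alpha> ((\<beta>^^2) x) \<star> (\<alpha>^^2) (\<beta> y)) \<cdot> (\<beta> ((\<alpha>^^2) z) \<cdot> (\<phi>^^3) v)) x y z = 0"
    and left_jordan_identity:
    "(\<beta>^^2) ((\<alpha>^^2) z) \<cdot> (\<beta> ((\<alpha>^^2) y) \<cdot> ((\<alpha>^^2) x \<cdot> inv \<psi> ((\<phi>^^3) v)))
      + (\<beta>^^2) ((\<alpha>^^2) x) \<cdot> (\<beta> ((\<alpha>^^2) y) \<cdot> ((\<alpha>^^2) z \<cdot> inv \<psi> ((\<phi>^^3) v)))
      + (((\<beta>^^2) x \<star> \<beta> (\<alpha> z)) \<star> \<beta> ((\<alpha>^^2) y)) \<cdot> (\<phi>^^3) (\<psi> v)
      = ((\<beta>^^2) (\<alpha> y) \<star> \<beta> ((\<alpha>^^2) z)) \<cdot> (\<beta> ((\<alpha>^^2) x) \<cdot> (\<phi>^^3) v)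
      + ((\<beta>^^2) (\<alpha> y) \<star> \<beta> ((\<alpha>^^2) x)) \<cdot> (\<beta> ((\<alpha>^^2) z) \<cdot> (\<phi>^^3) v)
      + ((\<beta>^^2) (\<alpha> x) \<star> \<beta> ((\<alpha>^^2) z)) \<cdot> (\<beta> ((\<alpha>^^2) y) \<cdot> (\<phi>^^3) v)"

locale left_special_bihom_jordan_module = left_bihom_jordan_module +
  assumes left_special:
    "(\<beta> x \<star> \<alpha> y) \<cdot> \<psi> v = \<beta> (\<alpha> x) \<cdot> (\<alpha> y \<cdot> v) + \<beta> (\<alpha> y) \<cdot> (\<alpha> x \<cdot> v)"

end

theory Submission
  imports Defs
begin

text \<open>
  In a regular BiHom-associative algebra the product \<open>x \<circ> y = \<mu> (\<alpha>\<inverse> x) (\<beta>\<inverse> y)\<close> is associative, and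
  \<open>A\<^sup>+\<close> is the twist of the Jordan product \<open>x \<circ> y + y \<circ> x\<close>. Module maps
  cannot be untwisted in this way, since \<open>\<phi>\<close> need not be invertible; instead the special
  identity, which is immediate from BiHom-associativity, rewrites every term of both module
  identities as a sum of threefold actions of permutations of \<open>x\<close>, \<open>y\<close>, \<open>z\<close>.
\<close>

lemma linear_map_add: "Vector_Spaces.linear s t f \<Longrightarrow> f (x + y) = f x + f y"
  by (rule module_hom.add[OF Vector_Spaces.linear.axioms(3)])

lemma linear_map_scale: "Vector_Spaces.linear s t f \<Longrightarrow> f (s c x) = t c (f x)"
  by (rule module_hom.scale[OF Vector_Spaces.linear.axioms(3)])

text \<open>Here \<open>j x x\<close> is twice the square of \<open>x\<close>. By distributivity and
  associativity both sides become the same sum: the four words with three letters \<open>x\<close>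
  and one \<open>y\<close>, each taken twice.\<close>

lemma jordan_identity_of_associative:
  fixes m :: "'a \<Rightarrow> 'a \<Rightarrow> 'a::ab_group_add"
  assumes add_left: "\<And>x y z. m (x + y) z = m x z + m y z"
    and add_right: "\<And>x y z. m x (y + z) = m x y + m x z"
    and assoc: "\<And>x y z. m (m x y) z = m x (m y z)"
  defines "j \<equiv> \<lambda>x y. m x y + m y x"
  shows "j (j (j x x) y) x = j (j x x) (j y x)"
  by (simp add: j_def add_left add_right assoc add_ac)

context regular_bihom_associative_algebra
begin

lemma mult_add_left: "\<mu> (x + y) z = \<mu> x z + \<mu> y z"
  and mult_add_right: "\<mu> x (y + z) = \<mu> x y + \<mu> x z"
  and alpha_add: "\<alpha> (x + y) = \<alpha> x + \<alpha> y"
  and beta_add: "\<beta> (x + y) = \<beta> x + \<beta> y"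
  using linear_map_add[OF mult_linear_left] linear_map_add[OF mult_linear_right]
    linear_map_add[OF alpha_linear] linear_map_add[OF beta_linear] by auto

lemma mult_scale_left: "\<mu> (scaleA c x) z = scaleA c (\<mu> x z)"
  and mult_scale_right: "\<mu> x (scaleA c z) = scaleA c (\<mu> x z)"
  and alpha_scale: "\<alpha> (scaleA c x) = scaleA c (\<alpha> x)"
  and beta_scale: "\<beta> (scaleA c x) = scaleA c (\<beta> x)"
  using linear_map_scale[OF mult_linear_left] linear_map_scale[OF mult_linear_right]
    linear_map_scale[OF alpha_linear] linear_map_scale[OF beta_linear] by auto

lemma beta_alpha: "\<beta> (\<alpha> x) = \<alpha> (\<beta> x)"
  using alpha_beta_commute by (metis comp_apply)

lemma inv_alpha [simp]: "inv \<alpha> (\<alpha> x) = x" "\<alpha> (inv \<alpha> x) = x"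
  and inv_beta [simp]: "inv \<beta> (\<beta> x) = x" "\<beta> (inv \<beta> x) = x"
  using alpha_bij beta_bij by (simp_all add: bij_is_inj bij_is_surj surj_f_inv_f)

lemma inv_alpha_eqI: "\<alpha> y = x \<Longrightarrow> inv \<alpha> x = y"
  and inv_beta_eqI: "\<beta> y = x \<Longrightarrow> inv \<beta> x = y"
  by auto

lemma inv_alpha_add: "inv \<alpha> (x + y) = inv \<alpha> x + inv \<alpha> y"
  and inv_beta_add: "inv \<beta> (x + y) = inv \<beta> x + inv \<beta> y"
  by (auto intro!: inv_alpha_eqI inv_beta_eqI simp: alpha_add beta_add)

lemma inv_alpha_scale: "inv \<alpha> (scaleA c x) = scaleA c (inv \<alpha> x)"
  and inv_beta_scale: "inv \<beta> (scaleA c x) = scaleA c (inv \<beta> x)"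
  by (auto intro!: inv_alpha_eqI inv_beta_eqI simp: alpha_scale beta_scale)

lemma inv_alpha_mult: "inv \<alpha> (\<mu> x y) = \<mu> (inv \<alpha> x) (inv \<alpha> y)"
  and inv_beta_mult: "inv \<beta> (\<mu> x y) = \<mu> (inv \<beta> x) (inv \<beta> y)"
  by (auto intro!: inv_alpha_eqI inv_beta_eqI simp: alpha_mult beta_mult)

lemma inv_alpha_beta: "inv \<alpha> (\<beta> x) = \<beta> (inv \<alpha> x)"
  and inv_beta_alpha: "inv \<beta> (\<alpha> x) = \<alpha> (inv \<beta> x)"
  and inv_beta_inv_alpha: "inv \<beta> (inv \<alpha> x) = inv \<alpha> (inv \<beta> x)"
proof -
  show 1: "inv \<alpha> (\<beta> x) = \<beta> (inv \<alpha> x)" for x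
    by (rule inv_alpha_eqI) (simp flip: beta_alpha)
  show "inv \<beta> (\<alpha> x) = \<alpha> (inv \<beta> x)"
    by (rule inv_beta_eqI) (simp add: beta_alpha)
  show "inv \<beta> (inv \<alpha> x) = inv \<alpha> (inv \<beta> x)"
    by (rule inv_beta_eqI) (simp flip: 1)
qed

lemma mult_assoc: "\<mu> (\<mu> x y) (\<beta> z) = \<mu> (\<alpha> x) (\<mu> y z)"
  using associator_zero[of x y z] by (simp add: bihom_associator_def)

definition untwisted_mult :: "'b \<Rightarrow> 'b \<Rightarrow> 'b" (infixl \<open>\<odot>\<close> 75) where
  "x \<odot> y = \<mu> (inv \<alpha> x) (inv \<beta> y)"

lemma untwisted_mult_add:
  "(x + y) \<odot> z = x \<odot> z + y \<odot> z" "x \<odot> (y + z) = x \<odot> y + x \<odot> z"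
  by (simp_all add: untwisted_mult_def inv_alpha_add inv_beta_add mult_add_left mult_add_right)

lemma untwisted_mult_assoc: "x \<odot> y \<odot> z = x \<odot> (y \<odot> z)"
  \<comment> \<open>The inner factor of a nested \<open>\<odot>\<close> is twisted twice:
    \<open>x\<close> by \<alpha>^-2 on the left, \<open>z\<close> by \<beta>^-2 on the right, and
    \<open>y\<close> by \<alpha>^-1 \<beta>^-1 in both bracketings. These are the arguments at which
    BiHom-associativity is used.\<close>
  using mult_assoc[of "inv \<alpha> (inv \<alpha> x)" "inv \<alpha> (inv \<beta> y)" "inv \<beta> (inv \<beta> z)"]
  by (simp add: untwisted_mult_def inv_alpha_mult inv_beta_mult inv_beta_inv_alpha)

lemma alpha_untwisted_mult: "\<alpha> (x \<odot> y) = \<alpha> x \<odot> \<alpha> y"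
  and beta_untwisted_mult: "\<beta> (x \<odot> y) = \<beta> x \<odot> \<beta> y"
  by (simp_all add: untwisted_mult_def alpha_mult beta_mult inv_alpha_beta inv_beta_alpha)

lemma plus_mult_untwisted: "plus_mult \<mu> \<alpha> \<beta> x y = \<alpha> x \<odot> \<beta> y + \<beta> y \<odot> \<alpha> x"
  by (simp add: plus_mult_def untwisted_mult_def)

text \<open>On arguments of this shape the inverse twists cancel, since \<alpha> and \<beta>
  commute. The result is visibly symmetric in \<open>x\<close> and \<open>y\<close>, which gives
  BiHom-commutativity, and it is the product occurring in the special identities.\<close>

lemma plus_mult_beta_alpha: "plus_mult \<mu> \<alpha> \<beta> (\<beta> x) (\<alpha> y) = \<mu> (\<beta> x) (\<alpha> y) + \<mu> (\<beta> y) (\<alpha> x)"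
  by (simp add: plus_mult_def beta_alpha) (simp flip: beta_alpha)

lemma bihom_jordan_algebra_plus: "bihom_jordan_algebra scaleA (plus_mult \<mu> \<alpha> \<beta>) \<alpha> \<beta>"
proof (intro bihom_jordan_algebra.intro bihom_jordan_algebra_axioms.intro
    multiplicative_bihom_algebra.intro multiplicative_bihom_algebra_axioms.intro
    bihom_algebra.intro bihom_algebra_axioms.intro)
  note lin = mult_add_left mult_add_right mult_scale_left mult_scale_right alpha_add beta_add
    alpha_scale beta_scale inv_alpha_add inv_beta_add inv_alpha_scale inv_beta_scale
    A.scale_right_distrib
  show "Vector_Spaces.linear scaleA scaleA (\<lambda>x. plus_mult \<mu> \<alpha> \<beta> x y)" for y
    by unfold_locales (simp_all add: plus_mult_def lin add_ac)
  show "Vector_Spaces.linear scaleA scaleA (plus_mult \<mu> \<alpha> \<beta> x)" for x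
    by unfold_locales (simp_all add: plus_mult_def lin add_ac)
  note plus = plus_mult_untwisted alpha_add beta_add alpha_untwisted_mult beta_untwisted_mult
    beta_alpha
  show "\<alpha> (plus_mult \<mu> \<alpha> \<beta> x y) = plus_mult \<mu> \<alpha> \<beta> (\<alpha> x) (\<alpha> y)" for x y
    by (simp add: plus)
  show "\<beta> (plus_mult \<mu> \<alpha> \<beta> x y) = plus_mult \<mu> \<alpha> \<beta> (\<beta> x) (\<beta> y)" for x y
    by (simp add: plus)
  show "plus_mult \<mu> \<alpha> \<beta> (\<beta> x) (\<alpha> y) = plus_mult \<mu> \<alpha> \<beta> (\<beta> y) (\<alpha> x)" for x y
    by (simp add: plus_mult_beta_alpha add.commute)
  show "bihom_associator (plus_mult \<mu> \<alpha> \<beta>) \<alpha> \<beta>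
      (plus_mult \<mu> \<alpha> \<beta> ((\<beta>^^2) x) (\<alpha> (\<beta> x))) ((\<alpha>^^2) (\<beta> y)) ((\<alpha>^^3) x) = 0" for x y
    \<comment> \<open>Once the twists are pushed down to the variables, every \<open>x\<close> and
      every \<open>y\<close> in the BiHom-Jordan identity carries the same twist \<alpha>^3
      \<beta>^2, so what remains is the ordinary Jordan identity for \<open>\<odot>\<close>.\<close>
    using jordan_identity_of_associative[where m = untwisted_mult,
        OF untwisted_mult_add untwisted_mult_assoc,
        of "\<alpha> (\<alpha> (\<alpha> (\<beta> (\<beta> x))))" "\<alpha> (\<alpha> (\<alpha> (\<beta> (\<beta> y))))"]
    by (simp add: bihom_associator_def plus numeral_2_eq_2 numeral_3_eq_3)
qed (fact A.vector_space_axioms alpha_linear beta_linear alpha_beta_commute)+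

end

text \<open>The special identity splits an action by a product into two successive actions. Applied
  repeatedly, it turns both Jordan module identities into equalities between sums of threefold
  actions.\<close>

lemma right_special_imp_jordan_module:
  assumes jordan: "bihom_jordan_algebra scaleA \<mu> \<alpha> \<beta>" and surj: "surj \<beta>"
    and str: "right_structure_map scaleA \<mu> \<alpha> \<beta> scaleV \<phi> \<psi> \<rho>"
    and special: "\<And>v x y. \<rho> (\<phi> v) (\<mu> (\<beta> x) (\<alpha> y))
      = \<rho> (\<rho> v (\<beta> x)) (\<beta> (\<alpha> y)) + \<rho> (\<rho> v (\<beta> y)) (\<alpha> (\<beta> x))"
  shows "right_special_bihom_jordan_module scaleA \<mu> \<alpha> \<beta> scaleV \<phi> \<psi> \<rho>"
proof -
  interpret J: bihom_jordan_algebra scaleA \<mu> \<alpha> \<beta> by fact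
  interpret right_structure_map scaleA \<mu> \<alpha> \<beta> scaleV \<phi> \<psi> \<rho> by fact
  have ba: "\<beta> (\<alpha> x) = \<alpha> (\<beta> x)" for x
    using J.alpha_beta_commute by (metis comp_apply)
  have add_left: "\<rho> (u + v) a = \<rho> u a + \<rho> v a" for u v a
    using linear_map_add[OF act_linear_left] by auto
  have special': "\<rho> (\<phi> v) (\<mu> (\<beta> x) (\<alpha> y))
      = \<rho> (\<rho> v (\<beta> x)) (\<alpha> (\<beta> y)) + \<rho> (\<rho> v (\<beta> y)) (\<alpha> (\<beta> x))" for v x y
    using special[of v x y] by (simp add: ba)
  have outer: "\<rho> (\<rho> (\<phi> u) (\<alpha> a)) (\<mu> (\<beta> x) (\<alpha> y))
      = \<rho> (\<rho> (\<rho> u a) (\<beta> x)) (\<alpha> (\<beta> y)) + \<rho> (\<rho> (\<rho> u a) (\<beta> y)) (\<alpha> (\<beta> x))" for u a x y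
    using special'[of "\<rho> u a"] by (simp add: phi_act)
  have inner: "\<rho> (\<rho> (\<phi> u) (\<mu> (\<beta> x) (\<alpha> y))) a
      = \<rho> (\<rho> (\<rho> u (\<beta> x)) (\<alpha> (\<beta> y))) a + \<rho> (\<rho> (\<rho> u (\<beta> y)) (\<alpha> (\<beta> x))) a" for u a x y
    by (simp add: special' add_left)
  \<comment> \<open>The normal form of every term. The exponent of \<alpha> grows by one with each
    further action, and \<open>u\<close> will be \<psi>^2 \<open>v\<close>.\<close>
  define t where "t u x y z = \<rho> (\<rho> (\<rho> u (\<alpha> (\<beta> x))) (\<alpha> (\<alpha> (\<beta> y)))) (\<alpha> (\<alpha> (\<alpha> (\<beta> z))))"
    for u x y z
  have first: "\<rho> (\<rho> (\<phi> u) (\<mu> (\<alpha> (\<beta> x)) (\<alpha> (\<alpha> y)))) (\<alpha> (\<alpha> (\<alpha> (\<beta> z)))) = t u x y z + t u y x z"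
    for u x y z
    using inner[of u "\<alpha> x" "\<alpha> y" "\<alpha> (\<alpha> (\<alpha> (\<beta> z)))"] by (simp add: ba t_def)
  have second: "\<rho> (\<rho> (\<phi> u) (\<alpha> (\<alpha> (\<beta> z)))) (\<mu> (\<alpha> (\<alpha> (\<beta> x))) (\<alpha> (\<alpha> (\<alpha> y)))) = t u z x y + t u z y x"
    for u x y z
    using outer[of u "\<alpha> (\<beta> z)" "\<alpha> (\<alpha> x)" "\<alpha> (\<alpha> y)"] by (simp add: ba t_def)
  have third: "\<rho> (\<phi> (\<phi> u)) (\<mu> (\<mu> (\<alpha> (\<beta> x)) (\<alpha> (\<alpha> z))) (\<alpha> (\<alpha> (\<alpha> y))))
      = t u x z y + t u z x y + t u y x z + t u y z x" for u x y z
  proof -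
    \<comment> \<open>The special identity wants a left factor of the form \<beta> \<open>q\<close>,
      but \<open>\<alpha> (\<alpha> z)\<close> shows no \<beta> to pull out of the product.
      Surjectivity of \<beta> supplies \<open>q\<close>; afterwards \<open>q\<close> is eliminated
      through its image.\<close>
    obtain q where q: "\<mu> (\<alpha> (\<beta> x)) (\<alpha> (\<alpha> z)) = \<beta> q"
      using surj by (metis surjD)
    show ?thesis
      using special'[of "\<phi> u" q "\<alpha> (\<alpha> y)"] first[of u x z y] second[of u y x z]
      by (simp add: ba J.alpha_mult add.assoc flip: q)
  qed
  \<comment> \<open>In the cyclic identity both cyclic sums run over all six orderings of
    \<open>x\<close>, \<open>y\<close>, \<open>z\<close>, so they cancel. In the other identity the
    six orderings arise as 1+1+4 on the left and 2+2+2 on the right.\<close>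
  show ?thesis
    by unfold_locales
      (simp_all add: cyclic_sum_def special numeral_2_eq_2 numeral_3_eq_3 ba first second third
        flip: t_def)
qed

text \<open>The mirror image of the right-hand argument, with the same count of orderings; now
  \<psi> on the module vector takes the part of \<phi>.\<close>

lemma left_special_imp_jordan_module:
  assumes jordan: "bihom_jordan_algebra scaleA \<mu> \<alpha> \<beta>" and bij: "bij \<psi>"
    and str: "left_structure_map scaleA \<mu> \<alpha> \<beta> scaleV \<phi> \<psi> \<rho>"
    and special: "\<And>v x y. \<rho> (\<mu> (\<beta> x) (\<alpha> y)) (\<psi> v)
      = \<rho> (\<beta> (\<alpha> x)) (\<rho> (\<alpha> y) v) + \<rho> (\<beta> (\<alpha> y)) (\<rho> (\<alpha> x) v)"
  shows "left_special_bihom_jordan_module scaleA \<mu> \<alpha> \<beta> scaleV \<phi> \<psi> \<rho>"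
proof -
  interpret J: bihom_jordan_algebra scaleA \<mu> \<alpha> \<beta> by fact
  interpret left_structure_map scaleA \<mu> \<alpha> \<beta> scaleV \<phi> \<psi> \<rho> by fact
  have ba: "\<beta> (\<alpha> x) = \<alpha> (\<beta> x)" for x
    using J.alpha_beta_commute by (metis comp_apply)
  have add_right: "\<rho> a (u + v) = \<rho> a u + \<rho> a v" for u v a
    using linear_map_add[OF act_linear_right] by auto
  have special': "\<rho> (\<mu> (\<beta> x) (\<alpha> y)) (\<psi> v)
      = \<rho> (\<alpha> (\<beta> x)) (\<rho> (\<alpha> y) v) + \<rho> (\<alpha> (\<beta> y)) (\<rho> (\<alpha> x) v)" for v x y
    using special[of x y v] by (simp add: ba)
  have outer: "\<rho> (\<mu> (\<beta> x) (\<alpha> y)) (\<rho> (\<beta> a) (\<psi> u))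
      = \<rho> (\<alpha> (\<beta> x)) (\<rho> (\<alpha> y) (\<rho> a u)) + \<rho> (\<alpha> (\<beta> y)) (\<rho> (\<alpha> x) (\<rho> a u))" for u a x y
    using special'[of _ _ "\<rho> a u"] by (simp add: psi_act)
  have inner: "\<rho> a (\<rho> (\<mu> (\<beta> x) (\<alpha> y)) (\<psi> u))
      = \<rho> a (\<rho> (\<alpha> (\<beta> x)) (\<rho> (\<alpha> y) u)) + \<rho> a (\<rho> (\<alpha> (\<beta> y)) (\<rho> (\<alpha> x) u))" for u a x y
    by (simp add: special' add_right)
  \<comment> \<open>Here the exponent of \<alpha> stays fixed and that of \<beta> falls from the
    outermost action inwards.\<close>
  define t where "t x y z u = \<rho> (\<alpha> (\<alpha> (\<beta> (\<beta> x)))) (\<rho> (\<alpha> (\<alpha> (\<beta> y))) (\<rho> (\<alpha> (\<alpha> z)) u))"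
    for u x y z
  have first: "\<rho> (\<alpha> (\<alpha> (\<beta> (\<beta> z)))) (\<rho> (\<mu> (\<alpha> (\<beta> x)) (\<alpha> (\<alpha> y))) (\<psi> u)) = t z x y u + t z y x u"
    for u x y z
    using inner[of "\<alpha> (\<alpha> (\<beta> (\<beta> z)))" "\<alpha> x" "\<alpha> y" u] by (simp add: ba t_def)
  have second: "\<rho> (\<mu> (\<alpha> (\<beta> (\<beta> x))) (\<alpha> (\<alpha> (\<beta> y)))) (\<rho> (\<alpha> (\<alpha> (\<beta> z))) (\<psi> u)) = t x y z u + t y x z u"
    for u x y z
    using outer[of "\<alpha> (\<beta> x)" "\<alpha> (\<beta> y)" "\<alpha> (\<alpha> z)" u] by (simp add: ba t_def)
  \<comment> \<open>The inner product is \<beta> applied to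
    \<open>\<mu> (\<beta> x) (\<alpha> z)\<close>, because \<beta> is multiplicative, so the special
    identity applies to it directly.\<close>
  have third: "\<rho> (\<mu> (\<mu> (\<beta> (\<beta> x)) (\<alpha> (\<beta> z))) (\<alpha> (\<alpha> (\<beta> y)))) (\<psi> (\<psi> u))
      = t x z y u + t z x y u + t y x z u + t y z x u" for u x y z
    using special'[of "\<mu> (\<beta> x) (\<alpha> z)" "\<alpha> (\<beta> y)" "\<psi> u"] first[of y x z u] second[of x z y u]
    by (simp add: ba J.alpha_mult J.beta_mult add.assoc)
  have psi_inv: "\<psi> (inv \<psi> v) = v" for v
    using bij by (simp add: bij_is_surj surj_f_inv_f)
  have inv_psi: "inv \<psi> (\<psi> v) = v" for v
    using bij by (simp add: bij_is_inj)
  have phi_psi: "\<phi> (\<psi> v) = \<psi> (\<phi> v)" for v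
    using V.phi_psi_commute by (metis comp_apply)
  \<comment> \<open>\<open>w v\<close> is \<psi>^-1 \<phi>^3 \<open>v\<close>. The module vectors in
    the two identities are then \<open>w v\<close> and its images under \<psi> and \<psi>^2, as
    \<open>t\<close>, \<open>first\<close>, \<open>second\<close> and \<open>third\<close> expect.
    Keeping \<open>w\<close> opaque prevents the rewriting of \<phi>^3 from looping.\<close>
  obtain w where w: "\<And>v. \<phi> (\<phi> (\<phi> v)) = \<psi> (w v)"
    by (rule that[of "\<lambda>v. inv \<psi> (\<phi> (\<phi> (\<phi> v)))"]) (simp only: psi_inv)
  show ?thesis
  proof
    show "\<rho> (\<mu> (\<beta> x) (\<alpha> y)) (\<psi> v)
      = \<rho> (\<beta> (\<alpha> x)) (\<rho> (\<alpha> y) v) + \<rho> (\<beta> (\<alpha> y)) (\<rho> (\<alpha> x) v)" for x y v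
      by (fact special)
  qed (simp_all add: cyclic_sum_def numeral_2_eq_2 numeral_3_eq_3 bij phi_psi w inv_psi ba
        first second third flip: t_def)
qed

context regular_bihom_associative_algebra
begin

lemma right_special_bihom_jordan_module_plus:
  assumes "right_bihom_associative_module scaleA \<mu> \<alpha> \<beta> scaleV \<phi> \<psi> \<rho>"
  shows "right_special_bihom_jordan_module scaleA (plus_mult \<mu> \<alpha> \<beta>) \<alpha> \<beta> scaleV \<phi> \<psi> \<rho>"
proof -
  interpret M: right_bihom_associative_module scaleA \<mu> \<alpha> \<beta> scaleV \<phi> \<psi> \<rho> by fact
  interpret P: bihom_jordan_algebra scaleA "plus_mult \<mu> \<alpha> \<beta>" \<alpha> \<beta>
    by (fact bihom_jordan_algebra_plus)
  have add_right: "\<rho> v (a + b) = \<rho> v a + \<rho> v b" for v a b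
    using linear_map_add[OF M.act_linear_right] by auto
  show ?thesis
  proof (rule right_special_imp_jordan_module)
    show "right_structure_map scaleA (plus_mult \<mu> \<alpha> \<beta>) \<alpha> \<beta> scaleV \<phi> \<psi> \<rho>"
      by (intro right_structure_map.intro right_structure_map_axioms.intro P.bihom_algebra_axioms
          M.V.bihom_module_axioms M.act_linear_left M.act_linear_right M.phi_act M.psi_act)
    \<comment> \<open>The product of \<open>A^+\<close> splits into two products in
      \<open>A\<close>, and BiHom-associativity of the action turns each of them into one summand on
      the right.\<close>
    show "\<rho> (\<phi> v) (plus_mult \<mu> \<alpha> \<beta> (\<beta> x) (\<alpha> y))
        = \<rho> (\<rho> v (\<beta> x)) (\<beta> (\<alpha> y)) + \<rho> (\<rho> v (\<beta> y)) (\<alpha> (\<beta> x))" for v x y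
      by (simp add: plus_mult_beta_alpha add_right M.act_assoc beta_alpha)
  qed (use beta_bij bihom_jordan_algebra_plus in \<open>auto simp: bij_is_surj\<close>)
qed

lemma left_special_bihom_jordan_module_plus:
  assumes "left_bihom_associative_module scaleA \<mu> \<alpha> \<beta> scaleV \<phi> \<psi> \<rho>" and "bij \<psi>"
  shows "left_special_bihom_jordan_module scaleA (plus_mult \<mu> \<alpha> \<beta>) \<alpha> \<beta> scaleV \<phi> \<psi> \<rho>"
proof -
  interpret M: left_bihom_associative_module scaleA \<mu> \<alpha> \<beta> scaleV \<phi> \<psi> \<rho> by fact
  interpret P: bihom_jordan_algebra scaleA "plus_mult \<mu> \<alpha> \<beta>" \<alpha> \<beta>
    by (fact bihom_jordan_algebra_plus)
  have add_left: "\<rho> (a + b) v = \<rho> a v + \<rho> b v" for v a b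
    using linear_map_add[OF M.act_linear_left] by auto
  show ?thesis
  proof (rule left_special_imp_jordan_module)
    show "left_structure_map scaleA (plus_mult \<mu> \<alpha> \<beta>) \<alpha> \<beta> scaleV \<phi> \<psi> \<rho>"
      by (intro left_structure_map.intro left_structure_map_axioms.intro P.bihom_algebra_axioms
          M.V.bihom_module_axioms M.act_linear_left M.act_linear_right M.phi_act M.psi_act)
    show "\<rho> (plus_mult \<mu> \<alpha> \<beta> (\<beta> x) (\<alpha> y)) (\<psi> v)
        = \<rho> (\<beta> (\<alpha> x)) (\<rho> (\<alpha> y) v) + \<rho> (\<beta> (\<alpha> y)) (\<rho> (\<alpha> x) v)" for v x y
      by (simp add: plus_mult_beta_alpha add_left beta_alpha flip: M.act_assoc)
  qed (fact bihom_jordan_algebra_plus \<open>bij \<psi>\<close>)+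
qed

end

theorem lemma4p25:
  fixes scaleA :: "'k::{alg_closed_field, field_char_0} \<Rightarrow> 'a::ab_group_add \<Rightarrow> 'a"
    and \<mu> :: "'a \<Rightarrow> 'a \<Rightarrow> 'a"
    and \<alpha> \<beta> :: "'a \<Rightarrow> 'a"
    and scaleV :: "'k \<Rightarrow> 'v::ab_group_add \<Rightarrow> 'v"
    and \<phi> \<psi> :: "'v \<Rightarrow> 'v"
  assumes "regular_bihom_associative_algebra scaleA \<mu> \<alpha> \<beta>"
    and "bihom_module scaleV \<phi> \<psi>"
  shows "(\<forall>\<rho>\<^sub>r :: 'v \<Rightarrow> 'a \<Rightarrow> 'v.
      right_bihom_associative_module scaleA \<mu> \<alpha> \<beta> scaleV \<phi> \<psi> \<rho>\<^sub>r \<longrightarrow>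
      right_special_bihom_jordan_module scaleA (plus_mult \<mu> \<alpha> \<beta>) \<alpha> \<beta> scaleV \<phi> \<psi> \<rho>\<^sub>r) \<and>
    (\<forall>\<rho>\<^sub>l :: 'a \<Rightarrow> 'v \<Rightarrow> 'v.
      left_bihom_associative_module scaleA \<mu> \<alpha> \<beta> scaleV \<phi> \<psi> \<rho>\<^sub>l \<and> bij \<psi> \<longrightarrow>
      left_special_bihom_jordan_module scaleA (plus_mult \<mu> \<alpha> \<beta>) \<alpha> \<beta> scaleV \<phi> \<psi> \<rho>\<^sub>l)"
  using regular_bihom_associative_algebra.right_special_bihom_jordan_module_plus[OF assms(1)]
    regular_bihom_associative_algebra.left_special_bihom_jordan_module_plus[OF assms(1)]
  by blast

end
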